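(* Let $c,s$ be positive integers. If $G$ is a finite simple graph that is $(c,s)$-normal, then $|V(G)|\leq 2^{c+s}$. Equivalently, $N(c,s)\leq 2^{c+s}$.
   Context: A normal cover of a graph $G$ is a pair $(\mathcal C,\mathcal S)$ where $\mathcal C$ is a set of cliques of $G$ covering every vertex of $G$, $\mathcal S$ is a set of stable (independent) sets of $G$ covering every vertex of $G$, and every clique in $\mathcal C$ and every stable set in $\mathcal S$ have a vertex in common. For positive integers $c,s$, a $(c,s)$-normal cover is a normal cover in which every clique of $\mathcal C$ has at most $c$ vertices and every stable set of $\mathcal S$ has at most $s$ vertices; $G$ is $(c,s)$-normal if it admits a $(c,s)$-normal cover. $N(c,s)$ denotes the maximum number of vertices of a $(c,s)$-normal graph. *)

theory Defs
  imports "HOL-Library.Ramsey"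
begin

text \<open>
  Graphs are pairs of a vertex set \<open>V\<close> and a set \<open>E\<close> of two-element subsets of \<open>V\<close>, so that
  \<^const>\<open>clique\<close> and \<^const>\<open>indep\<close> from the Ramsey theory are applicable.
\<close>

definition finite_simple_graph :: "'a set \<Rightarrow> 'a set set \<Rightarrow> bool" where
  "finite_simple_graph V E \<longleftrightarrow> finite V \<and> E \<subseteq> [V]\<^bsup>2\<^esup>"

definition normal_cover :: "'a set \<Rightarrow> 'a set set \<Rightarrow> 'a set set \<Rightarrow> 'a set set \<Rightarrow> bool" where
  "normal_cover V E \<C> \<S> \<longleftrightarrow>
     (\<forall>K\<in>\<C>. K \<subseteq> V \<and> clique K E) \<and> \<Union>\<C> = V \<and>
     (\<forall>S\<in>\<S>. S \<subseteq> V \<and> indep S E) \<and> \<Union>\<S> = V \<and>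
     (\<forall>K\<in>\<C>. \<forall>S\<in>\<S>. K \<inter> S \<noteq> {})"

definition cs_normal_cover ::
    "nat \<Rightarrow> nat \<Rightarrow> 'a set \<Rightarrow> 'a set set \<Rightarrow> 'a set set \<Rightarrow> 'a set set \<Rightarrow> bool" where
  "cs_normal_cover c s V E \<C> \<S> \<longleftrightarrow>
     normal_cover V E \<C> \<S> \<and>
     (\<forall>K\<in>\<C>. finite K \<and> card K \<le> c) \<and> (\<forall>S\<in>\<S>. finite S \<and> card S \<le> s)"

definition cs_normal :: "nat \<Rightarrow> nat \<Rightarrow> 'a set \<Rightarrow> 'a set set \<Rightarrow> bool" where
  "cs_normal c s V E \<longleftrightarrow> (\<exists>\<C> \<S>. cs_normal_cover c s V E \<C> \<S>)"

text \<open>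
  Vertices may be taken to be natural numbers: by \<open>cs_normal_card_in_orders\<close> below, graphs over
  other vertex types do not contribute any further orders.
\<close>

definition cs_normal_orders :: "nat \<Rightarrow> nat \<Rightarrow> nat set" where
  "cs_normal_orders c s =
     {card V | (V :: nat set) E. finite_simple_graph V E \<and> cs_normal c s V E}"

definition max_cs_normal :: "nat \<Rightarrow> nat \<Rightarrow> nat" where
  "max_cs_normal c s = Max (cs_normal_orders c s)"

lemma zero_in_cs_normal_orders: "0 \<in> cs_normal_orders c s"
proof -
  have "cs_normal_cover c s ({} :: nat set) {} {} {}"
    by (simp add: cs_normal_cover_def normal_cover_def)
  then have "finite_simple_graph ({} :: nat set) {} \<and> cs_normal c s ({} :: nat set) {}"
    by (auto simp: finite_simple_graph_def cs_normal_def)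
  then show ?thesis
    unfolding cs_normal_orders_def by (metis (mono_tags, lifting) card.empty mem_Collect_eq)
qed

lemma cs_normal_card_in_orders:
  fixes V :: "'a set"
  assumes G: "finite_simple_graph V E" and N: "cs_normal c s V E"
  shows "card V \<in> cs_normal_orders c s"
proof -
  from G have fin: "finite V" and E: "E \<subseteq> [V]\<^bsup>2\<^esup>"
    by (auto simp: finite_simple_graph_def)
  from fin obtain f :: "'a \<Rightarrow> nat" where f: "inj_on f V"
    using finite_imp_inj_to_nat_seg[OF fin] by auto
  from N obtain \<C> \<S> where nc: "cs_normal_cover c s V E \<C> \<S>"
    by (auto simp: cs_normal_def)
  let ?E = "(`) f ` E"
  have EV: "e \<subseteq> V" if "e \<in> E" for e
    using E that by (auto simp: nsets_def)
  have edge: "{f v, f w} \<in> ?E \<longleftrightarrow> {v, w} \<in> E" if "v \<in> V" "w \<in> V" for v w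
  proof
    assume "{f v, f w} \<in> ?E"
    then obtain e where e: "e \<in> E" "f ` e = f ` {v, w}" by auto
    then have "e = {v, w}"
      using inj_on_image_eq_iff[OF f EV[OF e(1)], of "{v, w}"] that by simp
    with e show "{v, w} \<in> E" by simp
  next
    assume "{v, w} \<in> E"
    then have "f ` {v, w} \<in> ?E" by blast
    then show "{f v, f w} \<in> ?E" by simp
  qed
  have cl: "clique (f ` K) ?E" if "K \<subseteq> V" "clique K E" for K
    unfolding clique_def
  proof (intro ballI impI)
    fix x y assume "x \<in> f ` K" "y \<in> f ` K" "x \<noteq> y"
    then obtain v w where "v \<in> K" "w \<in> K" "x = f v" "y = f w" "v \<noteq> w" by blast
    with that edge[of v w] show "{x, y} \<in> ?E" by (auto simp: clique_def subset_iff)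
  qed
  have ind: "indep (f ` K) ?E" if "K \<subseteq> V" "indep K E" for K
    unfolding indep_def
  proof (intro ballI impI)
    fix x y assume "x \<in> f ` K" "y \<in> f ` K" "x \<noteq> y"
    then obtain v w where "v \<in> K" "w \<in> K" "x = f v" "y = f w" "v \<noteq> w" by blast
    with that edge[of v w] show "{x, y} \<notin> ?E" by (auto simp: indep_def subset_iff)
  qed
  have "?E \<subseteq> [f ` V]\<^bsup>2\<^esup>"
  proof
    fix x assume "x \<in> ?E"
    then obtain e where e: "e \<in> E" "x = f ` e" by blast
    then have "card x = 2" "finite x" "x \<subseteq> f ` V"
      using E EV[OF e(1)] card_image[OF inj_on_subset[OF f EV[OF e(1)]]]
      by (auto simp: nsets_def)
    then show "x \<in> [f ` V]\<^bsup>2\<^esup>" by (simp add: nsets_def)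
  qed
  with fin have G': "finite_simple_graph (f ` V) ?E"
    by (simp add: finite_simple_graph_def)
  from nc have
      C: "\<And>K. K \<in> \<C> \<Longrightarrow> K \<subseteq> V \<and> clique K E \<and> finite K \<and> card K \<le> c" and
      S: "\<And>S. S \<in> \<S> \<Longrightarrow> S \<subseteq> V \<and> indep S E \<and> finite S \<and> card S \<le> s" and
      UC: "\<Union>\<C> = V" and US: "\<Union>\<S> = V" and
      meet: "\<And>K S. K \<in> \<C> \<Longrightarrow> S \<in> \<S> \<Longrightarrow> K \<inter> S \<noteq> {}"
    unfolding cs_normal_cover_def normal_cover_def by simp_all
  have "normal_cover (f ` V) ?E ((`) f ` \<C>) ((`) f ` \<S>)"
    unfolding normal_cover_def
  proof (intro conjI ballI)
    fix K assume "K \<in> (`) f ` \<C>"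
    then obtain L where L: "L \<in> \<C>" "K = f ` L" by (rule imageE)
    show "K \<subseteq> f ` V" using C[OF L(1)] L(2) by (simp add: image_mono)
    show "clique K ?E" using C[OF L(1)] L(2) cl by simp
    fix S assume "S \<in> (`) f ` \<S>"
    then obtain T where T: "T \<in> \<S>" "S = f ` T" by (rule imageE)
    from meet[OF L(1) T(1)] obtain x where "x \<in> L" "x \<in> T" by blast
    with L T have "f x \<in> K \<inter> S" by simp
    then show "K \<inter> S \<noteq> {}" by blast
  next
    fix S assume "S \<in> (`) f ` \<S>"
    then obtain T where T: "T \<in> \<S>" "S = f ` T" by (rule imageE)
    show "S \<subseteq> f ` V" using S[OF T(1)] T(2) by (simp add: image_mono)
    show "indep S ?E" using S[OF T(1)] T(2) ind by simp
  next
    show "\<Union>((`) f ` \<C>) = f ` V" "\<Union>((`) f ` \<S>) = f ` V"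
      using UC US by (simp_all only: image_Union[symmetric])
  qed
  moreover have "finite K \<and> card K \<le> c" if K: "K \<in> (`) f ` \<C>" for K
  proof -
    from K obtain L where L: "L \<in> \<C>" "K = f ` L" by (rule imageE)
    with C[OF L(1)] card_image_le[of L f] show ?thesis by simp
  qed
  moreover have "finite S \<and> card S \<le> s" if "S \<in> (`) f ` \<S>" for S
  proof -
    from that obtain T where T: "T \<in> \<S>" "S = f ` T" by (rule imageE)
    with S[OF T(1)] card_image_le[of T f] show ?thesis by simp
  qed
  ultimately have "cs_normal_cover c s (f ` V) ?E ((`) f ` \<C>) ((`) f ` \<S>)"
    unfolding cs_normal_cover_def by blast
  then have "cs_normal c s (f ` V) ?E"
    unfolding cs_normal_def by blast
  moreover have "card V = card (f ` V)"
    using f by (simp add: card_image)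
  ultimately show ?thesis
    using G' unfolding cs_normal_orders_def by blast
qed

end

theory Submission
  imports Defs Complex_Main
begin

text \<open>
  Assign to each vertex \<open>v\<close> a clique \<open>A v\<close> and a stable set \<open>B v\<close> of the cover that contain it, and
  give \<open>v\<close> the weight \<open>2^(-|B v|)\<close>. Let \<open>H\<close> be a smallest of the stable sets, and choose a
  uniformly random subset \<open>R\<close> of \<open>H\<close>. Keep the vertices \<open>v\<close> outside \<open>H\<close> for which
  \<open>A v \<inter> H \<subseteq> R\<close> and \<open>B v \<inter> R = {}\<close>, and delete \<open>H\<close> from their cliques and stable sets: what
  remains of them still meets in exactly one vertex, and every clique has lost exactly one vertex.
  A vertex outside \<open>H\<close> is kept with probability \<open>2^(-1 - |B v \<inter> H|)\<close>, so its expected new weight is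
  half of its old weight, while \<open>H\<close> itself weighs at most \<open>|H| 2^(-|H|) \<le> 1/2\<close>. Hence the largest
  total weight \<open>F k\<close> for cliques of size at most \<open>k\<close> satisfies \<open>F (k + 1) \<le> 1/2 + 2 F k\<close>, which
  gives \<open>F k \<le> (2^k - 1)/2\<close>.
\<close>

lemma card_subsets_between:
  assumes "finite Y" "X \<subseteq> Y"
  shows "card {R. X \<subseteq> R \<and> R \<subseteq> Y} = 2 ^ card (Y - X)"
proof -
  have "bij_betw ((\<union>) X) (Pow (Y - X)) {R. X \<subseteq> R \<and> R \<subseteq> Y}"
    by (rule bij_betw_byWitness[where f' = "\<lambda>R. R - X"]) (use assms in auto)
  then have "card {R. X \<subseteq> R \<and> R \<subseteq> Y} = card (Pow (Y - X))"
    by (rule bij_betw_same_card[symmetric])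
  then show ?thesis
    using assms by (simp add: card_Pow)
qed

definition weight :: "'a set \<Rightarrow> ('a \<Rightarrow> 'b set) \<Rightarrow> real" where
  "weight V B = (\<Sum>v\<in>V. (1/2) ^ card (B v))"

locale uniquely_cross_intersecting =
  fixes V :: "'a set" and A B :: "'a \<Rightarrow> 'a set"
  assumes finite_V: "finite V"
    and finite_A: "v \<in> V \<Longrightarrow> finite (A v)"
    and finite_B: "v \<in> V \<Longrightarrow> finite (B v)"
    and mem_A: "v \<in> V \<Longrightarrow> v \<in> A v"
    and mem_B: "v \<in> V \<Longrightarrow> v \<in> B v"
    and is_singleton_Int: "v \<in> V \<Longrightarrow> w \<in> V \<Longrightarrow> is_singleton (A v \<inter> B w)"
begin

lemma Int_same_eq: "v \<in> V \<Longrightarrow> A v \<inter> B v = {v}"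
  using is_singleton_Int[of v v] mem_A[of v] mem_B[of v] by (metis IntI is_singletonE singletonD)

lemma card_A_eq_Suc:
  assumes "v \<in> V" "w \<in> V"
  shows "card (A v) = Suc (card (A v - B w))"
proof -
  have "card (A v) = card (A v \<inter> B w) + card (A v - B w)"
    using finite_A[OF assms(1)] by (rule card_Int_Diff)
  then show ?thesis
    using is_singleton_Int[OF assms] by (simp add: is_singleton_altdef)
qed

definition survivors :: "'a set \<Rightarrow> 'a set \<Rightarrow> 'a set" where
  "survivors H R = {v \<in> V - H. A v \<inter> H \<subseteq> R \<and> B v \<inter> R = {}}"

lemma survivors_subset: "survivors H R \<subseteq> V - H"
  by (auto simp: survivors_def)

lemma uniquely_cross_intersecting_survivors:
  "uniquely_cross_intersecting (survivors H R) (\<lambda>v. A v - H) (\<lambda>v. B v - H)"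
proof
  show "finite (survivors H R)"
    using survivors_subset finite_V by (rule finite_subset[OF _ finite_Diff])
next
  fix v w assume vw: "v \<in> survivors H R" "w \<in> survivors H R"
  then have "(A v \<inter> H) \<inter> B w = {}"
    by (auto simp: survivors_def)
  then have "(A v - H) \<inter> (B w - H) = A v \<inter> B w"
    by blast
  then show "is_singleton ((A v - H) \<inter> (B w - H))"
    using vw is_singleton_Int by (simp add: survivors_def)
qed (auto simp: survivors_def intro: finite_A finite_B mem_A mem_B)

lemma card_surviving_choices:
  assumes "h \<in> V" "v \<in> V - B h"
  shows "2 * 2 ^ card (B v \<inter> B h) * card {R \<in> Pow (B h). v \<in> survivors (B h) R} = 2 ^ card (B h)"
proof -
  have v: "v \<in> V" and fin: "finite (B h)"
    using assms finite_B by auto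
  obtain x where x: "A v \<inter> B h = {x}"
    using is_singleton_Int[OF v assms(1)] by (auto simp: is_singleton_def)
  then have x_in_A: "x \<in> A v" and x_in_B_h: "x \<in> B h"
    by auto
  have "x \<notin> B v"
  proof
    assume "x \<in> B v"
    with x_in_A have "x = v"
      using Int_same_eq[OF v] by blast
    with x_in_B_h assms(2) show False
      by simp
  qed
  with x_in_B_h have x_in_Diff: "x \<in> B h - B v"
    by blast
  have "{R \<in> Pow (B h). v \<in> survivors (B h) R} = {R. {x} \<subseteq> R \<and> R \<subseteq> B h - B v}"
    using assms(2) x by (auto simp: survivors_def)
  then have choices_card:
    "card {R \<in> Pow (B h). v \<in> survivors (B h) R} = 2 ^ card (B h - B v - {x})"
    using card_subsets_between[of "B h - B v" "{x}"] x_in_Diff fin by simp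
  have "card (B h) = card (B h \<inter> B v) + card (B h - B v)"
    using fin by (rule card_Int_Diff)
  also have "card (B h - B v) = Suc (card (B h - B v - {x}))"
    using fin x_in_Diff by (simp only: card_Suc_Diff1 finite_Diff)
  finally show ?thesis
    unfolding choices_card by (simp add: power_add Int_commute)
qed

lemma sum_surviving_weight:
  assumes "h \<in> V" "v \<in> V - B h"
  shows "(\<Sum>R\<in>{R \<in> Pow (B h). v \<in> survivors (B h) R}. (1/2 :: real) ^ card (B v - B h))
       = 2 ^ card (B h) / 2 * (1/2) ^ card (B v)"
proof -
  let ?n = "card {R \<in> Pow (B h). v \<in> survivors (B h) R}"
  have "card (B v) = card (B v \<inter> B h) + card (B v - B h)"
    using assms(2) by (intro card_Int_Diff finite_B) simp
  moreover have "(2 :: real) ^ card (B h) = 2 * 2 ^ card (B v \<inter> B h) * ?n"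
    using card_surviving_choices[OF assms] by (metis of_nat_mult of_nat_numeral of_nat_power)
  ultimately show ?thesis
    by (simp add: power_add power_one_over)
qed

lemma sum_weight_survivors:
  assumes "h \<in> V"
  shows "(\<Sum>R\<in>Pow (B h). weight (survivors (B h) R) (\<lambda>v. B v - B h))
       = 2 ^ card (B h) / 2 * weight (V - B h) B"
proof -
  have "(\<Sum>R\<in>Pow (B h). weight (survivors (B h) R) (\<lambda>v. B v - B h))
      = (\<Sum>R\<in>Pow (B h). \<Sum>v\<in>{v \<in> V - B h. v \<in> survivors (B h) R}. (1/2) ^ card (B v - B h))"
    unfolding weight_def using survivors_subset by (intro sum.cong refl) blast
  also have "\<dots> = (\<Sum>v\<in>V - B h. \<Sum>R\<in>{R \<in> Pow (B h). v \<in> survivors (B h) R}.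
                      (1/2) ^ card (B v - B h))"
    using finite_V finite_B[OF assms] by (intro sum.swap_restrict) auto
  also have "\<dots> = (\<Sum>v\<in>V - B h. 2 ^ card (B h) / 2 * (1/2) ^ card (B v))"
    using assms by (intro sum.cong refl sum_surviving_weight)
  finally show ?thesis
    by (simp only: weight_def sum_distrib_left)
qed

lemma weight_Diff_le:
  assumes "h \<in> V" "\<And>R. R \<subseteq> B h \<Longrightarrow> weight (survivors (B h) R) (\<lambda>v. B v - B h) \<le> W"
  shows "weight (V - B h) B \<le> 2 * W"
proof -
  have "2 ^ card (B h) / 2 * weight (V - B h) B
      = (\<Sum>R\<in>Pow (B h). weight (survivors (B h) R) (\<lambda>v. B v - B h))"
    using assms(1) by (rule sum_weight_survivors[symmetric])
  also have "\<dots> \<le> card (Pow (B h)) * W"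
    by (intro sum_bounded_above assms(2)) simp
  also have "\<dots> = 2 ^ card (B h) / 2 * (2 * W)"
    using finite_B[OF assms(1)] by (simp add: card_Pow)
  finally show ?thesis
    by (simp add: mult_le_cancel_left)
qed

lemma weight_Int_le_half:
  assumes "h \<in> V" "\<And>v. v \<in> V \<Longrightarrow> card (B h) \<le> card (B v)"
  shows "weight (V \<inter> B h) B \<le> 1/2"
proof -
  have "weight (V \<inter> B h) B \<le> card (V \<inter> B h) * (1/2) ^ card (B h)"
    unfolding weight_def by (intro sum_bounded_above power_decreasing) (auto intro: assms(2))
  also have "\<dots> \<le> card (B h) * (1/2) ^ card (B h)"
    using finite_B[OF assms(1)] by (intro mult_right_mono) (auto intro: card_mono)
  also have "\<dots> \<le> 1/2"
  proof -
    have "card (B h) \<noteq> 0"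
      using finite_B mem_B assms(1) by auto
    then obtain n where n: "card (B h) = Suc n"
      using not0_implies_Suc by blast
    have "real (Suc n) \<le> 2 ^ n"
      using Suc_leI[OF less_exp[of n]] by (metis of_nat_le_iff of_nat_numeral of_nat_power)
    then show ?thesis
      by (simp add: n power_one_over field_simps)
  qed
  finally show ?thesis .
qed

end

lemma uniquely_cross_intersecting_imp_weight_le:
  assumes "uniquely_cross_intersecting V A B" "\<And>v. v \<in> V \<Longrightarrow> card (A v) \<le> k"
  shows "weight V B \<le> (2 ^ k - 1) / 2"
  using assms
proof (induction k arbitrary: V A B)
  case 0
  interpret uniquely_cross_intersecting V A B by fact
  have "V = {}"
    using "0.prems"(2) finite_A mem_A by fastforce
  then show ?case
    by (simp add: weight_def)
next
  case (Suc k)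
  interpret uniquely_cross_intersecting V A B by fact
  show ?case
  proof (cases "V = {}")
    case True
    then show ?thesis
      using one_le_power[of "2 :: real" "Suc k"] by (simp add: weight_def)
  next
    case False
    then obtain h where h: "h \<in> V" and h_min: "\<And>v. v \<in> V \<Longrightarrow> card (B h) \<le> card (B v)"
      using ex_has_least_nat[of "\<lambda>v. v \<in> V" _ "\<lambda>v. card (B v)"] by (metis all_not_in_conv)
    have "weight (survivors (B h) R) (\<lambda>v. B v - B h) \<le> (2 ^ k - 1) / 2" for R
    proof (rule Suc.IH[OF uniquely_cross_intersecting_survivors])
      fix v assume "v \<in> survivors (B h) R"
      then have "v \<in> V"
        using survivors_subset by blast
      then show "card (A v - B h) \<le> k"
        using card_A_eq_Suc[of v h] h Suc.prems(2)[of v] by simp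
    qed
    then have "weight (V - B h) B \<le> 2 * ((2 ^ k - 1) / 2)"
      using h by (intro weight_Diff_le)
    moreover have "weight V B = weight (V \<inter> B h) B + weight (V - B h) B"
      unfolding weight_def using finite_V by (rule sum.Int_Diff)
    ultimately show ?thesis
      using weight_Int_le_half[OF h h_min] by simp
  qed
qed

lemma is_singleton_clique_Int_indep:
  assumes "clique K E" "indep S E" "K \<inter> S \<noteq> {}"
  shows "is_singleton (K \<inter> S)"
  using assms(3)
proof (rule is_singletonI')
  show "x = y" if "x \<in> K \<inter> S" "y \<in> K \<inter> S" for x y
    using assms that by (auto simp: clique_def indep_def)
qed

lemma cs_normal_imp_uniquely_cross_intersecting:
  assumes "finite V" "cs_normal c s V E"
  obtains A B where "uniquely_cross_intersecting V A B"
    and "\<And>v. v \<in> V \<Longrightarrow> card (A v) \<le> c" and "\<And>v. v \<in> V \<Longrightarrow> card (B v) \<le> s"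
proof -
  from assms(2) obtain \<C> \<S> where "cs_normal_cover c s V E \<C> \<S>"
    by (auto simp: cs_normal_def)
  then have clique: "\<And>K. K \<in> \<C> \<Longrightarrow> clique K E \<and> finite K \<and> card K \<le> c"
    and indep: "\<And>S. S \<in> \<S> \<Longrightarrow> indep S E \<and> finite S \<and> card S \<le> s"
    and covers: "\<Union>\<C> = V" "\<Union>\<S> = V"
    and meet: "\<And>K S. K \<in> \<C> \<Longrightarrow> S \<in> \<S> \<Longrightarrow> K \<inter> S \<noteq> {}"
    unfolding cs_normal_cover_def normal_cover_def by simp_all
  have "\<forall>v\<in>V. \<exists>K. K \<in> \<C> \<and> v \<in> K" and "\<forall>v\<in>V. \<exists>S. S \<in> \<S> \<and> v \<in> S"
    using covers by blast+
  then obtain A B where A: "\<forall>v\<in>V. A v \<in> \<C> \<and> v \<in> A v" and B: "\<forall>v\<in>V. B v \<in> \<S> \<and> v \<in> B v"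
    unfolding bchoice_iff by blast
  show thesis
  proof
    show "uniquely_cross_intersecting V A B"
    proof
      show "is_singleton (A v \<inter> B w)" if "v \<in> V" "w \<in> V" for v w
        using that A B clique indep meet
        by (intro is_singleton_clique_Int_indep[of _ E]) auto
    qed (use assms(1) A B clique indep in auto)
  qed (use A B clique indep in auto)
qed

lemma cs_normal_two_mult_card_le:
  assumes "finite V" "cs_normal c s V E"
  shows "2 * card V \<le> 2 ^ s * (2 ^ c - 1)"
proof -
  obtain A B where system: "uniquely_cross_intersecting V A B"
    and card_A: "\<And>v. v \<in> V \<Longrightarrow> card (A v) \<le> c"
    and card_B: "\<And>v. v \<in> V \<Longrightarrow> card (B v) \<le> s"
    using assms by (rule cs_normal_imp_uniquely_cross_intersecting) blast
  have "card V * (1/2) ^ s \<le> weight V B"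
    unfolding weight_def by (intro sum_bounded_below power_decreasing) (auto intro: card_B)
  also have "\<dots> \<le> (2 ^ c - 1) / 2"
    using system card_A by (rule uniquely_cross_intersecting_imp_weight_le)
  finally have "real (2 * card V) \<le> real (2 ^ s * (2 ^ c - 1))"
    by (simp add: power_one_over of_nat_diff field_simps)
  then show ?thesis
    by (simp only: of_nat_le_iff)
qed

lemma cs_normal_card_le:
  assumes "finite_simple_graph V E" "cs_normal c s V E"
  shows "card V \<le> 2 ^ (c + s)"
proof -
  have "card V \<le> 2 * card V"
    by simp
  also have "\<dots> \<le> 2 ^ s * (2 ^ c - 1)"
    using assms by (intro cs_normal_two_mult_card_le) (simp_all add: finite_simple_graph_def)
  also have "\<dots> \<le> 2 ^ (c + s)"
    by (simp add: power_add)
  finally show ?thesis .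
qed

theorem theorem1:
  fixes c s :: nat
  assumes "c > 0" and "s > 0"
  shows "(\<forall>(V :: 'a set) E. finite_simple_graph V E \<and> cs_normal c s V E \<longrightarrow> card V \<le> 2 ^ (c + s))
         \<and> max_cs_normal c s \<le> 2 ^ (c + s)"
proof
  show "\<forall>(V :: 'a set) E. finite_simple_graph V E \<and> cs_normal c s V E \<longrightarrow> card V \<le> 2 ^ (c + s)"
    by (blast intro: cs_normal_card_le)
  have orders_le: "cs_normal_orders c s \<subseteq> {..2 ^ (c + s)}"
    by (auto simp: cs_normal_orders_def intro: cs_normal_card_le)
  then have "finite (cs_normal_orders c s)"
    by (rule finite_subset) simp
  then have "max_cs_normal c s \<in> cs_normal_orders c s"
    unfolding max_cs_normal_def using zero_in_cs_normal_orders by (intro Max_in) auto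
  with orders_le show "max_cs_normal c s \<le> 2 ^ (c + s)"
    by auto
qed

end
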